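(* Let $a,b\in\mathbb{N}$ with $a\le b$. The code $\mathcal{C}_0=\mathcal{C}_0(a,b)$ has dimension $\dim(\mathcal{C}_0)=a+b-1$ and minimum distance $d(\mathcal{C}_0)=a$. The special case $a\in\{1,2\}$ allows the following explicit description. \begin{enumerate} \item[(1)] If $1=a\le b$, then $\mathcal{C}_0=\mathcal{V}$. \item[(2)] If $2=a=b$, then $\mathcal{C}_0=\{\mathbf{v}\in\mathcal{V} : \operatorname{wt}(\mathbf{v})\equiv 0 \pmod 2\}$. \item[(3)] If $2=a<b$, then $\mathcal{C}_0=\{\sum_{i,j} c_{ij}\mathbf{e}_{ij} : c_{ij}\in\mathbb{F}_2,\ c_{1j}+c_{2j}=c_{1k}+c_{2k}\text{ for all } j,k\in\{1,\ldots,b\}\}$. \end{enumerate}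
   Context: $\mathbb{N}$ denotes the positive integers. For $a,b\in\mathbb{N}$ with $a\le b$, let $\mathcal{V}=\operatorname{Mat}(a,b,\mathbb{F}_2)$ be the $\mathbb{F}_2$-vector space of $a\times b$ matrices, with standard basis the elementary matrices $\mathbf{e}_{ij}$, $1\le i\le a$, $1\le j\le b$ ($\mathbf{e}_{ij}$ has entry $1$ in position $(i,j)$ and $0$ elsewhere). Define the elementary row matrices $\mathbf{r}_i=\sum_{j=1}^b\mathbf{e}_{ij}$ ($1\le i\le a$) and the elementary column matrices $\mathbf{c}_j=\sum_{i=1}^a\mathbf{e}_{ij}$ ($1\le j\le b$), and let $\mathcal{C}_0(a,b)\le\mathcal{V}$ be the $\mathbb{F}_2$-span of $\{\mathbf{r}_1,\ldots,\mathbf{r}_a,\mathbf{c}_1,\ldots,\mathbf{c}_b\}$. The weight $\operatorname{wt}(\mathbf{v})$ of $\mathbf{v}\in\mathcal{V}$ is its number of non-zero entries, and the minimum distance $d(\mathcal{C})$ of a subspace $\mathcal{C}\le\mathcal{V}$ is the minimum of $\operatorname{wt}(\mathbf{v})$ over non-zero $\mathbf{v}\in\mathcal{C}$. *)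

theory Defs
  imports "HOL-Library.Z2" "Jordan_Normal_Form.VS_Connect"
begin

text \<open>The field with two elements is the type \<^typ>\<open>bit\<close>. Matrices carry their dimensions and are
  indexed from 0, so row \<open>i\<close> (\<open>1 \<le> i \<le> a\<close>) of the usual notation is row \<open>i - 1\<close> here, and
  likewise for columns.\<close>

abbreviation F2 :: "bit ring" where
  "F2 \<equiv> class_ring"

abbreviation mat_space :: "nat \<Rightarrow> nat \<Rightarrow> (bit, bit mat) module" where
  "mat_space a b \<equiv> module_mat TYPE(bit) a b"

definition elem_mat :: "nat \<Rightarrow> nat \<Rightarrow> nat \<Rightarrow> nat \<Rightarrow> bit mat" where
  "elem_mat a b i j = mat a b (\<lambda>(k, l). if k = i \<and> l = j then 1 else 0)"

definition elem_row_mat :: "nat \<Rightarrow> nat \<Rightarrow> nat \<Rightarrow> bit mat" where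
  "elem_row_mat a b i = finsum (mat_space a b) (\<lambda>j. elem_mat a b i j) {..<b}"

definition elem_col_mat :: "nat \<Rightarrow> nat \<Rightarrow> nat \<Rightarrow> bit mat" where
  "elem_col_mat a b j = finsum (mat_space a b) (\<lambda>i. elem_mat a b i j) {..<a}"

definition C0 :: "nat \<Rightarrow> nat \<Rightarrow> bit mat set" where
  "C0 a b = LinearCombinations.module.span F2 (mat_space a b)
     (elem_row_mat a b ` {..<a} \<union> elem_col_mat a b ` {..<b})"

definition code_dim :: "nat \<Rightarrow> nat \<Rightarrow> bit mat set \<Rightarrow> nat" where
  "code_dim a b C = vectorspace.dim F2 ((mat_space a b)\<lparr>carrier := C\<rparr>)"

definition wt :: "bit mat \<Rightarrow> nat" where
  "wt v = card {(i, j). i < dim_row v \<and> j < dim_col v \<and> v $$ (i, j) \<noteq> 0}"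

definition min_dist :: "nat \<Rightarrow> nat \<Rightarrow> bit mat set \<Rightarrow> nat" where
  "min_dist a b C = Min (wt ` (C - {0\<^sub>m a b}))"

text \<open>The locale constants used above (span, dimension) are meaningful only over a vector space
  and, for the dimension, on a subspace.\<close>

lemma vectorspace_mat: "vectorspace F2 (mat_space a b)"
proof -
  interpret abelian_group "mat_space a b" by (rule abelian_group_mat)
  have "field F2" by (rule class_field)
  then interpret field F2 .
  show ?thesis
    by unfold_locales
      (auto simp: module_mat_simps class_ring_simps
        add_smult_distrib_right_mat add_smult_distrib_left_mat intro!: eq_matI simp: algebra_simps)
qed

lemma subspace_C0: "subspace F2 (C0 a b) (mat_space a b)"
proof -
  interpret vectorspace F2 "mat_space a b" by (rule vectorspace_mat)
  have E: "elem_mat a b i j \<in> carrier (mat_space a b)" for i j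
    by (simp add: elem_mat_def module_mat_simps)
  have "elem_row_mat a b i \<in> carrier (mat_space a b)"
    and "elem_col_mat a b j \<in> carrier (mat_space a b)" for i j
    unfolding elem_row_mat_def elem_col_mat_def using E by (auto intro!: M.finsum_closed)
  then show ?thesis
    unfolding C0_def by (intro span_is_subspace) auto
qed

end

theory Submission
  imports Defs
begin

text \<open>
  The key is that a combination of elementary row and column matrices, with coefficients \<open>x\<^sub>i\<close> on
  the rows and \<open>y\<^sub>j\<close> on the columns, has entry \<open>x\<^sub>i + y\<^sub>j\<close> at position \<open>(i, j)\<close>. So \<open>C0 a b\<close> is the
  set of all matrices of this form (\<open>C0_eq_outer_sums\<close>), and every claim is read off from
  the pair \<open>(x, y)\<close>.

  Dimension: the pair \<open>(x, y)\<close> is determined by its matrix up to adding one constant to both \<open>x\<close>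
  and \<open>y\<close>. Normalising \<open>y\<^sub>0 = 0\<close> leaves \<open>a + b - 1\<close> free parameters, which gives
  a linear bijection from the space of vectors of that length onto the code (\<open>code_dim_C0\<close>).

  Minimum distance: if \<open>x\<close> takes both values, then every one of the \<open>b \<ge> a\<close> columns contains a
  non-zero entry. If \<open>x\<close> is constant, then all entries of a column are equal, and a
  non-zero codeword has a column of \<open>a\<close> ones (\<open>wt_outer_sum_ge\<close>). A single
  column matrix attains the bound \<open>a\<close>.

  Explicit descriptions: a matrix with one row is the outer sum with \<open>x = 0\<close> and \<open>y\<close> its only
  row. A matrix with two rows is an outer sum if and only if its two rows differ by a constant, that
  is, all its column sums agree (\<open>C0_two_rows_iff\<close>). For a 2 by 2 matrix, the two column sums agree
  exactly when the sum of the four entries is zero in the field with two elements, that is, when the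
  weight is even.
\<close>

text \<open>The calculations below use the field axioms, and rewriting addition and multiplication to
  bit operations would hide these from the simplifier.\<close>

declare add_bit_eq_xor [simp del] mult_bit_eq_and [simp del]

section \<open>Outer sums of two vectors\<close>

definition outer_sum :: "nat \<Rightarrow> nat \<Rightarrow> (nat \<Rightarrow> bit) \<Rightarrow> (nat \<Rightarrow> bit) \<Rightarrow> bit mat" where
  "outer_sum a b x y = mat a b (\<lambda>(i, j). x i + y j)"

lemma outer_sum_carrier [simp]: "outer_sum a b x y \<in> carrier_mat a b"
  by (simp add: outer_sum_def)

lemma outer_sum_dim [simp]: "dim_row (outer_sum a b x y) = a" "dim_col (outer_sum a b x y) = b"
  by (simp_all add: outer_sum_def)

lemma outer_sum_index [simp]: "i < a \<Longrightarrow> j < b \<Longrightarrow> outer_sum a b x y $$ (i, j) = x i + y j"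
  by (simp add: outer_sum_def)

lemma outer_sum_cong:
  "(\<And>i. i < a \<Longrightarrow> x i = x' i) \<Longrightarrow> (\<And>j. j < b \<Longrightarrow> y j = y' j) \<Longrightarrow>
    outer_sum a b x y = outer_sum a b x' y'"
  by (intro eq_matI) simp_all

lemma add_outer_sum:
  "outer_sum a b x y + outer_sum a b x' y' = outer_sum a b (\<lambda>i. x i + x' i) (\<lambda>j. y j + y' j)"
  by (intro eq_matI) (simp_all add: add_ac)

lemma smult_outer_sum:
  "c \<cdot>\<^sub>m outer_sum a b x y = outer_sum a b (\<lambda>i. c * x i) (\<lambda>j. c * y j)"
  by (intro eq_matI) (simp_all add: distrib_left)

lemma zero_mat_eq_outer_sum: "0\<^sub>m a b = outer_sum a b (\<lambda>_. 0) (\<lambda>_. 0)"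
  by (intro eq_matI) simp_all

section \<open>The code consists of the outer sums\<close>

lemma finsum_mat_entrywise:
  fixes f :: "'s \<Rightarrow> 'a :: field mat"
  assumes "finite S" and "\<And>s. s \<in> S \<Longrightarrow> f s \<in> carrier_mat a b"
  shows "finsum (module_mat TYPE('a) a b) f S = mat a b (\<lambda>p. \<Sum>s\<in>S. f s $$ p)"
proof -
  interpret abelian_group "module_mat TYPE('a) a b" by (rule abelian_group_mat)
  show ?thesis
    using assms
  proof induction
    case empty
    then show ?case by (auto simp: module_mat_simps)
  next
    case (insert p S)
    have "finsum (module_mat TYPE('a) a b) f (insert p S) = f p + mat a b (\<lambda>q. \<Sum>s\<in>S. f s $$ q)"
      using insert by (subst finsum_insert) (auto simp: module_mat_simps)
    also have "\<dots> = mat a b (\<lambda>q. \<Sum>s\<in>insert p S. f s $$ q)"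
      using insert by (intro eq_matI) auto
    finally show ?case .
  qed
qed

lemma elem_row_mat_eq: "elem_row_mat a b i = outer_sum a b (\<lambda>k. if k = i then 1 else 0) (\<lambda>_. 0)"
  unfolding elem_row_mat_def
  by (subst finsum_mat_entrywise) (auto intro!: eq_matI simp: elem_mat_def if_distrib cong: if_cong)

lemma elem_col_mat_eq: "elem_col_mat a b j = outer_sum a b (\<lambda>_. 0) (\<lambda>l. if l = j then 1 else 0)"
  unfolding elem_col_mat_def
  by (subst finsum_mat_entrywise) (auto intro!: eq_matI simp: elem_mat_def if_distrib cong: if_cong)

lemma submodule_outer_sum: "submodule F2 {outer_sum a b x y |x y. True} (mat_space a b)"
proof -
  interpret vectorspace F2 "mat_space a b" by (rule vectorspace_mat)
  have "module F2 (mat_space a b)" ..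
  then show ?thesis
    unfolding submodule_def
    by (auto simp: module_mat_simps zero_mat_eq_outer_sum) (metis add_outer_sum, metis smult_outer_sum)
qed

text \<open>The outer sum of \<open>x\<close> and \<open>y\<close> is a combination of the generators with coefficients \<open>x i\<close> and
  \<open>y j\<close>. The combination is built one generator at a time, by induction on the number of
  rows or columns used, so that only closure of the code under addition and scaling is needed.\<close>

lemma outer_sum_in_C0: "outer_sum a b x y \<in> C0 a b"
proof -
  interpret vectorspace F2 "mat_space a b" by (rule vectorspace_mat)
  interpret C: submodule F2 "C0 a b" "mat_space a b"
    using subspace_C0 by (simp add: subspace_def)
  let ?G = "elem_row_mat a b ` {..<a} \<union> elem_col_mat a b ` {..<b}"
  have "?G \<subseteq> C0 a b"
    unfolding C0_def
    by (rule in_own_span) (auto simp: elem_row_mat_eq elem_col_mat_eq module_mat_simps)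
  then have row: "i < a \<Longrightarrow> elem_row_mat a b i \<in> C0 a b"
    and col: "j < b \<Longrightarrow> elem_col_mat a b j \<in> C0 a b" for i j
    by auto
  have add: "u + v \<in> C0 a b" if "u \<in> C0 a b" "v \<in> C0 a b" for u v
    using C.m_closed[OF that] by (simp add: module_mat_simps)
  have smult: "c \<cdot>\<^sub>m u \<in> C0 a b" if "u \<in> C0 a b" for c u
    using C.smult_closed[of c u] that by (simp add: module_mat_simps)
  have zero: "outer_sum a b (\<lambda>_. 0) (\<lambda>_. 0) \<in> C0 a b"
    using C.zero_closed by (simp add: module_mat_simps zero_mat_eq_outer_sum)
  have rows: "n \<le> a \<Longrightarrow> outer_sum a b (\<lambda>i. if i < n then x i else 0) (\<lambda>_. 0) \<in> C0 a b" for n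
  proof (induction n)
    case (Suc n)
    have "outer_sum a b (\<lambda>i. if i < Suc n then x i else 0) (\<lambda>_. 0) =
        outer_sum a b (\<lambda>i. if i < n then x i else 0) (\<lambda>_. 0) + x n \<cdot>\<^sub>m elem_row_mat a b n"
      unfolding elem_row_mat_eq smult_outer_sum add_outer_sum
      by (intro outer_sum_cong) (auto simp: less_Suc_eq)
    then show ?case using Suc add smult row by simp
  qed (use zero in simp)
  have cols: "n \<le> b \<Longrightarrow> outer_sum a b (\<lambda>_. 0) (\<lambda>j. if j < n then y j else 0) \<in> C0 a b" for n
  proof (induction n)
    case (Suc n)
    have "outer_sum a b (\<lambda>_. 0) (\<lambda>j. if j < Suc n then y j else 0) =
        outer_sum a b (\<lambda>_. 0) (\<lambda>j. if j < n then y j else 0) + y n \<cdot>\<^sub>m elem_col_mat a b n"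
      unfolding elem_col_mat_eq smult_outer_sum add_outer_sum
      by (intro outer_sum_cong) (auto simp: less_Suc_eq)
    then show ?case using Suc add smult col by simp
  qed (use zero in simp)
  have "outer_sum a b x y =
      outer_sum a b (\<lambda>i. if i < a then x i else 0) (\<lambda>_. 0) +
      outer_sum a b (\<lambda>_. 0) (\<lambda>j. if j < b then y j else 0)"
    unfolding add_outer_sum by (intro outer_sum_cong) auto
  then show ?thesis using add[OF rows[of a] cols[of b]] by simp
qed

lemma C0_eq_outer_sums: "C0 a b = {outer_sum a b x y |x y. True}"
proof
  interpret vectorspace F2 "mat_space a b" by (rule vectorspace_mat)
  show "C0 a b \<subseteq> {outer_sum a b x y |x y. True}"
    unfolding C0_def
    by (rule span_is_subset[OF _ submodule_outer_sum]) (auto simp: elem_row_mat_eq elem_col_mat_eq)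
  show "{outer_sum a b x y |x y. True} \<subseteq> C0 a b" by (auto simp: outer_sum_in_C0)
qed

section \<open>Dimension\<close>

text \<open>The first \<open>a\<close> coordinates of the vector are the coefficients of the rows, the remaining
  \<open>b - 1\<close> are those of the columns \<open>1, \<dots>, b - 1\<close>. The coefficient of column 0 is fixed to be 0,
  because the sum of all row matrices equals the sum of all column matrices.\<close>

definition code_param :: "nat \<Rightarrow> nat \<Rightarrow> bit vec \<Rightarrow> bit mat" where
  "code_param a b v = outer_sum a b (\<lambda>i. v $ i) (\<lambda>j. if j = 0 then 0 else v $ (a + j - 1))"

text \<open>Column 0 of the matrix shows the row coefficients, and then row 0 shows the column
  coefficients.\<close>

lemma inj_on_code_param:
  assumes "1 \<le> a" and "1 \<le> b"
  shows "inj_on (code_param a b) (carrier_vec (a + b - 1))"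
proof (rule inj_onI)
  fix v w assume v: "v \<in> carrier_vec (a + b - 1)" and w: "w \<in> carrier_vec (a + b - 1)"
    and eq: "code_param a b v = code_param a b w"
  have entry: "v $ i + (if j = 0 then 0 else v $ (a + j - 1)) =
      w $ i + (if j = 0 then 0 else w $ (a + j - 1))" if "i < a" "j < b" for i j
    using arg_cong[OF eq, of "\<lambda>M. M $$ (i, j)"] that by (simp add: code_param_def)
  show "v = w"
  proof (rule eq_vecI)
    fix k assume "k < dim_vec w"
    then have k: "k < a + b - 1" using w by simp
    have fst: "v $ i = w $ i" if "i < a" for i
      using entry[OF that, of 0] assms by simp
    show "v $ k = w $ k"
    proof (cases "k < a")
      case False
      then show ?thesis using entry[of 0 "k - a + 1"] fst[of 0] k assms
        by simp
    qed (rule fst)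
  qed (use v w in simp)
qed

lemma code_param_image:
  assumes "1 \<le> a" and "1 \<le> b"
  shows "code_param a b ` carrier_vec (a + b - 1) = C0 a b"
proof
  show "code_param a b ` carrier_vec (a + b - 1) \<subseteq> C0 a b"
    by (auto simp: code_param_def outer_sum_in_C0)
  show "C0 a b \<subseteq> code_param a b ` carrier_vec (a + b - 1)"
  proof
    fix M assume "M \<in> C0 a b"
    then obtain x y where M: "M = outer_sum a b x y" by (auto simp: C0_eq_outer_sums)
    \<comment> \<open>Adding the constant \<open>y 0\<close> to both \<open>x\<close> and \<open>y\<close> does not change the outer sum, because \<open>y 0 + y 0 = 0\<close>.\<close>
    define v where "v = vec (a + b - 1) (\<lambda>k. if k < a then x k + y 0 else y (k - a + 1) + y 0)"
    have "M = code_param a b v"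
      unfolding M
    proof (rule eq_matI, goal_cases)
      case (1 i j)
      then have i: "i < a" and j: "j < b" by (simp_all add: code_param_def)
      have cancel: "y 0 + (y 0 + z) = z" for z
        by (cases "y 0"; cases z) simp_all
      show ?case
        using i j assms
        by (cases j) (auto simp: code_param_def v_def add_ac cancel)
    qed (unfold code_param_def, simp_all)
    moreover have "v \<in> carrier_vec (a + b - 1)" by (simp add: v_def)
    ultimately show "M \<in> code_param a b ` carrier_vec (a + b - 1)" by blast
  qed
qed

lemma linear_map_code_param:
  assumes "1 \<le> a" and "1 \<le> b"
  shows "linear_map F2 (module_vec TYPE(bit) (a + b - 1)) (mat_space a b) (code_param a b)"
proof -
  let ?V = "module_vec TYPE(bit) (a + b - 1)"
  have "code_param a b (v + w) = code_param a b v + code_param a b w"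
    if "v \<in> carrier_vec (a + b - 1)" "w \<in> carrier_vec (a + b - 1)" for v w
    unfolding code_param_def add_outer_sum using that assms
    by (intro outer_sum_cong) auto
  moreover have "code_param a b (c \<cdot>\<^sub>v v) = c \<cdot>\<^sub>m code_param a b v"
    if "v \<in> carrier_vec (a + b - 1)" for c v
    unfolding code_param_def smult_outer_sum using that assms
    by (intro outer_sum_cong) auto
  moreover have "code_param a b v \<in> carrier_mat a b" for v
    by (simp add: code_param_def)
  ultimately have "mod_hom F2 ?V (mat_space a b) (code_param a b)"
    using vec_vs[of "a + b - 1", where 'a = bit] vectorspace_mat[of a b]
    unfolding mod_hom_def mod_hom_axioms_def LinearCombinations.module_hom_def vectorspace_def
    by (auto simp: module_vec_simps module_mat_simps)
  then show ?thesis
    using vec_vs[of "a + b - 1", where 'a = bit] vectorspace_mat[of a b]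
    by (simp add: linear_map_def)
qed

text \<open>Rank and nullity of the parametrisation: its kernel is trivial and its image is the code.\<close>

lemma code_dim_C0:
  assumes "1 \<le> a" and "1 \<le> b"
  shows "code_dim a b (C0 a b) = a + b - 1"
proof -
  let ?n = "a + b - 1"
  interpret V: vec_space "TYPE(bit)" ?n .
  interpret T: linear_map F2 "module_vec TYPE(bit) ?n" "mat_space a b" "code_param a b"
    using assms by (rule linear_map_code_param)
  have im: "T.imT = C0 a b"
    using code_param_image[OF assms] unfolding T.im_def by (simp add: module_vec_simps)
  have "vectorspace.dim F2 ((module_vec TYPE(bit) ?n)\<lparr>carrier := T.kerT\<rparr>) = 0"
    using inj_on_code_param[OF assms] by (intro T.inj_imp_dim_ker0) (simp add: module_vec_simps)
  then show ?thesis
    using T.rank_nullity V.fin_dim V.dim_is_n unfolding code_dim_def im by simp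
qed

section \<open>Minimum distance\<close>

lemma wt_ge:
  assumes "inj_on f S"
    and "\<And>s. s \<in> S \<Longrightarrow> f s \<in> {(i, j). i < dim_row v \<and> j < dim_col v \<and> v $$ (i, j) \<noteq> 0}"
  shows "card S \<le> wt v"
proof -
  have "finite {(i, j). i < dim_row v \<and> j < dim_col v \<and> v $$ (i, j) \<noteq> 0}"
    by (rule finite_subset[of _ "{..<dim_row v} \<times> {..<dim_col v}"]) auto
  then show ?thesis
    unfolding wt_def using assms
    by (intro card_inj_on_le[OF assms(1) image_subsetI])
qed

text \<open>Either every column contains a non-zero entry, because \<open>x\<close> takes two values and so the
  column does too, or every column is constant, and a non-zero column has weight \<open>a\<close>.\<close>

lemma wt_outer_sum_ge:
  assumes "a \<le> b" and "outer_sum a b x y \<noteq> 0\<^sub>m a b"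
  shows "a \<le> wt (outer_sum a b x y)"
proof (cases "\<exists>i k. i < a \<and> k < a \<and> x i \<noteq> x k")
  case True
  then obtain i k where ik: "i < a" "k < a" "x i \<noteq> x k" by blast
  have "\<forall>j. x i + y j \<noteq> 0 \<or> x k + y j \<noteq> 0"
    using ik(3) by (metis add_right_cancel)
  then have "card {..<b} \<le> wt (outer_sum a b x y)"
    using ik
    by (intro wt_ge[where f = "\<lambda>j. (if x i + y j \<noteq> 0 then i else k, j)"])
      (force intro!: inj_onI)+
  then show ?thesis using assms by simp
next
  case False
  have "\<exists>p<a. \<exists>q<b. x p + y q \<noteq> 0"
  proof (rule ccontr)
    assume "\<not> ?thesis"
    then have "outer_sum a b x y = 0\<^sub>m a b" by (intro eq_matI) auto
    with assms(2) show False by simp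
  qed
  then obtain p q where pq: "p < a" "q < b" "x p + y q \<noteq> 0" by blast
  have "x i + y q \<noteq> 0" if "i < a" for i
    using False pq that by metis
  then have "card {..<a} \<le> wt (outer_sum a b x y)"
    using pq
    by (intro wt_ge[where f = "\<lambda>i. (i, q)"]) (auto intro!: inj_onI)
  then show ?thesis by simp
qed

lemma min_dist_C0:
  assumes "1 \<le> a" and "a \<le> b"
  shows "min_dist a b (C0 a b) = a"
proof -
  let ?c = "outer_sum a b (\<lambda>_. 0) (\<lambda>j. if j = 0 then 1 else 0)"
  have "{(i, j). i < dim_row ?c \<and> j < dim_col ?c \<and> ?c $$ (i, j) \<noteq> 0} = (\<lambda>i. (i, 0)) ` {..<a}"
    using assms by (auto split: if_splits)
  then have wt: "wt ?c = a"
    by (simp add: wt_def card_image inj_on_def)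
  have "?c $$ (0, 0) \<noteq> 0\<^sub>m a b $$ (0, 0)" using assms by simp
  then have "?c \<noteq> 0\<^sub>m a b" by metis
  then have "a \<in> wt ` (C0 a b - {0\<^sub>m a b})"
    by (intro image_eqI[where x = ?c]) (simp_all add: wt outer_sum_in_C0)
  moreover have ge: "a \<le> w" if "w \<in> wt ` (C0 a b - {0\<^sub>m a b})" for w
    using that assms wt_outer_sum_ge by (auto simp: C0_eq_outer_sums)
  moreover have "finite (wt ` (C0 a b - {0\<^sub>m a b}))"
  proof (rule finite_subset)
    show "wt ` (C0 a b - {0\<^sub>m a b}) \<subseteq> {..a * b}"
    proof (rule image_subsetI)
      fix v assume "v \<in> C0 a b - {0\<^sub>m a b}"
      then have "v \<in> carrier_mat a b" by (auto simp: C0_eq_outer_sums)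
      then have "wt v \<le> card ({..<a} \<times> {..<b})"
        unfolding wt_def by (intro card_mono) auto
      then show "wt v \<in> {..a * b}" by simp
    qed
  qed simp
  ultimately show ?thesis
    unfolding min_dist_def by (intro Min_eqI) auto
qed

section \<open>Codes with one or two rows\<close>

lemma C0_one_row: "C0 1 b = carrier_mat 1 b"
proof
  show "carrier_mat 1 b \<subseteq> C0 1 b"
  proof
    fix v :: "bit mat" assume "v \<in> carrier_mat 1 b"
    then have "v = outer_sum 1 b (\<lambda>_. 0) (\<lambda>j. v $$ (0, j))" by (intro eq_matI) auto
    then show "v \<in> C0 1 b" by (metis outer_sum_in_C0)
  qed
  show "C0 1 b \<subseteq> carrier_mat 1 b" by (auto simp: C0_eq_outer_sums)
qed

text \<open>In an outer sum, the sum of column \<open>j\<close> is \<open>x 0 + x 1 + (y j + y j) = x 0 + x 1\<close>. Conversely, if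
  all column sums are equal, then row 1 is row 0 plus that common value.\<close>

lemma C0_two_rows_iff:
  assumes "1 \<le> b" and "v \<in> carrier_mat 2 b"
  shows "v \<in> C0 2 b \<longleftrightarrow>
    (\<forall>j<b. \<forall>k<b. v $$ (0, j) + v $$ (1, j) = v $$ (0, k) + v $$ (1, k))"
    (is "_ \<longleftrightarrow> ?const")
proof
  assume "v \<in> C0 2 b"
  then obtain x y where v: "v = outer_sum 2 b x y" by (auto simp: C0_eq_outer_sums)
  have "x 0 + z + (x 1 + z) = x 0 + x 1" for z
    by (cases "x 0"; cases "x 1"; cases z) simp_all
  then show ?const by (simp add: v)
next
  assume const: ?const
  define x where "x i = (if i = 0 then 0 else v $$ (0, 0) + v $$ (1, 0))" for i :: nat
  have cancel: "z + w + z = w" for z w :: bit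
    by (cases z; cases w) simp_all
  have "v = outer_sum 2 b x (\<lambda>j. v $$ (0, j))"
  proof (rule eq_matI, goal_cases)
    case (1 i j)
    then have j: "j < b" and i: "i = 0 \<or> i = 1" by auto
    have "v $$ (0, 0) + v $$ (1, 0) = v $$ (0, j) + v $$ (1, j)"
      using const[rule_format, of 0 j] j assms(1) by simp
    then show ?case
      using i j cancel by (auto simp: x_def)
  qed (use assms(2) in simp_all)
  then show "v \<in> C0 2 b" by (metis outer_sum_in_C0)
qed

lemma wt_eq_sum:
  assumes "v \<in> carrier_mat a b"
  shows "wt v = (\<Sum>i<a. \<Sum>j<b. if v $$ (i, j) \<noteq> 0 then 1 else 0)"
proof -
  have "wt v = card {p \<in> {..<a} \<times> {..<b}. v $$ p \<noteq> 0}"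
    unfolding wt_def using assms by (intro arg_cong[where f = card]) auto
  also have "\<dots> = (\<Sum>p\<in>{..<a} \<times> {..<b}. if v $$ p \<noteq> 0 then 1 else 0)"
    unfolding card_eq_sum by (rule sum.inter_filter) simp
  also have "\<dots> = (\<Sum>i<a. \<Sum>j<b. if v $$ (i, j) \<noteq> 0 then 1 else 0)"
    by (simp add: sum.cartesian_product case_prod_unfold)
  finally show ?thesis .
qed

lemma C0_two_by_two: "C0 2 2 = {v \<in> carrier_mat 2 2. even (wt v)}"
proof -
  have two: "{..<2} = {0, 1 :: nat}" and all_two: "(\<forall>j<2. P j) \<longleftrightarrow> P 0 \<and> P 1" for P :: "nat \<Rightarrow> bool"
    by (auto simp: numeral_2_eq_2 less_Suc_eq)
  have "v \<in> C0 2 2 \<longleftrightarrow> even (wt v)" if v: "v \<in> carrier_mat 2 2" for v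
    unfolding C0_two_rows_iff[OF one_le_numeral v] wt_eq_sum[OF v] two all_two
    by (cases "v $$ (0, 0)"; cases "v $$ (0, 1)"; cases "v $$ (1, 0)"; cases "v $$ (1, 1)")
      simp_all
  moreover have "C0 2 2 \<subseteq> carrier_mat 2 2" by (auto simp: C0_eq_outer_sums)
  ultimately show ?thesis by blast
qed

lemma C0_two_rows:
  assumes "1 \<le> b"
  shows "C0 2 b = {mat 2 b (\<lambda>(i, j). c i j) | c :: nat \<Rightarrow> nat \<Rightarrow> bit.
    \<forall>j<b. \<forall>k<b. c 0 j + c 1 j = c 0 k + c 1 k}" (is "_ = ?R")
proof
  show "C0 2 b \<subseteq> ?R"
  proof
    fix v assume v: "v \<in> C0 2 b"
    then have c: "v \<in> carrier_mat 2 b" by (auto simp: C0_eq_outer_sums)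
    then have "v = mat 2 b (\<lambda>(i, j). v $$ (i, j))" by (intro eq_matI) auto
    then show "v \<in> ?R"
      using v unfolding C0_two_rows_iff[OF assms c]
      by (intro CollectI exI[of _ "\<lambda>i j. v $$ (i, j)"] conjI)
  qed
  show "?R \<subseteq> C0 2 b"
  proof
    fix v assume "v \<in> ?R"
    then obtain c where v: "v = mat 2 b (\<lambda>(i, j). c i j)"
      and c: "\<forall>j<b. \<forall>k<b. c 0 j + c 1 j = c 0 k + (c 1 k :: bit)" by blast
    have "v $$ (0, j) + v $$ (1, j) = c 0 j + c 1 j" if "j < b" for j
      using that by (simp add: v)
    with c have "\<forall>j<b. \<forall>k<b. v $$ (0, j) + v $$ (1, j) = v $$ (0, k) + v $$ (1, k)" by metis
    then show "v \<in> C0 2 b"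
      by (subst C0_two_rows_iff[OF assms]) (simp_all only: v mat_carrier)
  qed
qed

theorem proposition3p1:
  fixes a b :: nat
  assumes "1 \<le> a" and "a \<le> b"
  shows "code_dim a b (C0 a b) = a + b - 1 \<and>
    min_dist a b (C0 a b) = a \<and>
    (a = 1 \<longrightarrow> C0 a b = carrier_mat a b) \<and>
    (a = 2 \<and> b = 2 \<longrightarrow> C0 a b = {v \<in> carrier_mat a b. even (wt v)}) \<and>
    (a = 2 \<and> a < b \<longrightarrow>
      C0 a b = {mat a b (\<lambda>(i, j). c i j) | c :: nat \<Rightarrow> nat \<Rightarrow> bit.
        \<forall>j<b. \<forall>k<b. c 0 j + c 1 j = c 0 k + c 1 k})"
proof -
  have b: "1 \<le> b" using assms by simp
  have one: "C0 a b = carrier_mat a b" if "a = 1"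
    unfolding that by (rule C0_one_row)
  have square: "C0 a b = {v \<in> carrier_mat a b. even (wt v)}" if "a = 2 \<and> b = 2"
    unfolding conjunct1[OF that] conjunct2[OF that] by (rule C0_two_by_two)
  have two: "C0 a b = {mat a b (\<lambda>(i, j). c i j) | c :: nat \<Rightarrow> nat \<Rightarrow> bit.
      \<forall>j<b. \<forall>k<b. c 0 j + c 1 j = c 0 k + c 1 k}" if "a = 2 \<and> a < b"
    unfolding conjunct1[OF that] by (rule C0_two_rows[OF b])
  show ?thesis
    by (intro conjI impI code_dim_C0[OF assms(1) b] min_dist_C0[OF assms]) (fact one square two)+
qed

end
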